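(* Let $E$ be a real vector space with (algebraic) dual space $E^*$, and let $C\subset E$ be a convex subset with more than one point. Let $f:C\to\mathbb{R}$ be a function that is radially lower stable at each flat point of $C$. Then $f$ is convex if and only if there exists $c^*\in E^*$, not constant on $C$, such that for every $\lambda\in\mathbb{R}$ the function $f+\lambda c^*:C\to\mathbb{R}$, $x\mapsto f(x)+\lambda\langle c^*,x\rangle$, is quasiconvex.
   Context: $E$ is a real vector space with no topology; $E^*$ is the space of all linear forms $E\to\mathbb{R}$, and $\langle c^*,x\rangle$ denotes the value of $c^*\in E^*$ at $x\in E$. For distinct $a,b\in E$, the open segment is $]a,b[\;=\{a+t(b-a): 0<t<1\}$. A function $f:C\to\mathbb{R}$ on a convex set $C\subset E$ is convex if $f(v+t(u-v))\le f(v)+t(f(u)-f(v))$ for all $u,v\in C$ and $t\in\,]0,1[$. It is quasiconvex if $f(v+t(u-v))\le\max\{f(u),f(v)\}$ for all $u,v\in C$ and $t\in\,]0,1[$. A function $f:C\to\mathbb{R}$ is radially lower stable at $z\in C$ if for every $w\in C$ one has $f(z)\le\limsup_{t\searrow 0} f(z+t(w-z))$, where $t$ tends to $0$ through positive values and the limsup is taken in $[-\infty,+\infty]$. A point $z\in C$ is a flat point of $C$ if there are three points $u,v,w\in C$ with $u\ne v$ and $w\neq z$ such that $z\in\,]u,v[$ and there is no $w'\in C$, $w'\ne w$, such that $z\in\,]w,w'[$. (The first condition says that $z$ is not an extreme point of $C$; the second says that $z$ is not in the intrinsic core, i.e. lies on the relative boundary, of $C$.) *)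

theory Defs
  imports "HOL-Analysis.Analysis"
begin

text \<open>Functions on \<open>C\<close> are total functions of which only the values on \<open>C\<close> matter;
  \<open>C\<close> is convex wherever the definitions are used.\<close>

definition quasiconvex_on :: "'a::real_vector set \<Rightarrow> ('a \<Rightarrow> real) \<Rightarrow> bool" where
  "quasiconvex_on C f \<longleftrightarrow>
     (\<forall>u\<in>C. \<forall>v\<in>C. \<forall>t. 0 < t \<and> t < 1 \<longrightarrow> f (v + t *\<^sub>R (u - v)) \<le> max (f u) (f v))"

text \<open>For \<open>z, w\<close> in the convex set \<open>C\<close> and \<open>0 < t \<le> 1\<close> the point \<open>z + t *\<^sub>R (w - z)\<close> lies
  in \<open>C\<close>, so the limit superior along \<open>at_right 0\<close> depends only on the values of \<open>f\<close> on \<open>C\<close>.\<close>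

definition radially_lower_stable_at ::
    "'a::real_vector set \<Rightarrow> ('a \<Rightarrow> real) \<Rightarrow> 'a \<Rightarrow> bool" where
  "radially_lower_stable_at C f z \<longleftrightarrow>
     (\<forall>w\<in>C. ereal (f z) \<le> Limsup (at_right 0) (\<lambda>t. ereal (f (z + t *\<^sub>R (w - z)))))"

text \<open>The conditions on \<open>u, v\<close> say that \<open>z\<close> is not an extreme point of \<open>C\<close>, those on \<open>w\<close>
  that \<open>z\<close> is not in the intrinsic core of \<open>C\<close>.\<close>

definition flat_point :: "'a::real_vector set \<Rightarrow> 'a \<Rightarrow> bool" where
  "flat_point C z \<longleftrightarrow> z \<in> C \<and>
     (\<exists>u\<in>C. \<exists>v\<in>C. \<exists>w\<in>C. u \<noteq> v \<and> w \<noteq> z \<and> z \<in> open_segment u v \<and>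
        \<not> (\<exists>w'\<in>C. w' \<noteq> w \<and> z \<in> open_segment w w'))"

end

theory Submission
  imports Defs
begin

text \<open>If \<open>c u \<noteq> c v\<close>, choosing \<open>\<mu>\<close> so that \<open>f + \<mu> c\<close> agrees at \<open>u\<close> and \<open>v\<close> turns
  quasiconvexity into the convexity inequality on \<open>[u, v]\<close>. If \<open>c u = c v\<close>, take \<open>w\<close> with
  \<open>c w \<noteq> c u\<close>: the convexity inequality then holds at all points of the triangle \<open>u, v, w\<close> off the
  side \<open>[u, v]\<close>, and it passes to a point \<open>z\<close> of that side along \<open>[z, w]\<close>: by radial lower
  stability if \<open>z\<close> is flat, and otherwise by extending \<open>[w, z]\<close> beyond \<open>z\<close> within \<open>C\<close> and using
  convexity on the extended segment.\<close>

text \<open>No topology is involved: a nonzero vector extends to a basis, so some linear form takes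
  the value 1 at \<open>x - y\<close>. This supplies the non-constant form when \<open>f\<close> is
  convex.\<close>

lemma exists_linear_separating_points:
  fixes x y :: "'a::real_vector"
  assumes "x \<noteq> y"
  obtains c :: "'a \<Rightarrow> real" where "linear c" "c x \<noteq> c y"
proof -
  have "independent {x - y}"
    using assms by simp
  then obtain c :: "'a \<Rightarrow> real" where c: "linear c" "c (x - y) = 1"
    using linear_independent_extend[of "{x - y}" "\<lambda>_. 1"] by auto
  then have "c x \<noteq> c y"
    by (auto simp: linear_diff)
  then show thesis
    using that c(1) by blast
qed

lemma convex_on_imp_quasiconvex_on:
  assumes "convex_on C f"
  shows "quasiconvex_on C f"
  unfolding quasiconvex_on_def
proof (intro ballI allI impI)
  fix u v and t :: real
  assume uv: "u \<in> C" "v \<in> C" and t: "0 < t \<and> t < 1"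
  have "f (v + t *\<^sub>R (u - v)) = f ((1 - t) *\<^sub>R v + t *\<^sub>R u)"
    by (simp add: algebra_simps)
  also have "\<dots> \<le> (1 - t) * f v + t * f u"
    using convex_onD[OF assms] uv t by simp
  also have "\<dots> \<le> (1 - t) * max (f u) (f v) + t * max (f u) (f v)"
    using t by (intro add_mono mult_left_mono) auto
  finally show "f (v + t *\<^sub>R (u - v)) \<le> max (f u) (f v)"
    by (simp add: algebra_simps)
qed

lemma convex_on_add_linear:
  assumes "convex_on C f" and "linear c"
  shows "convex_on C (\<lambda>x. f x + \<mu> * c x)"
proof (rule convex_on_add[OF assms(1)])
  show "convex_on C (\<lambda>x. \<mu> * c x)"
    using convex_on_imp_convex[OF assms(1)]
    by (intro convex_onI)
      (simp_all add: linear_add[OF assms(2)] linear_cmul[OF assms(2)] distrib_left mult.left_commute)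
qed

locale quasiconvex_linear_perturbations =
  fixes C :: "'a::real_vector set" and f c :: "'a \<Rightarrow> real"
  assumes convex: "convex C"
    and linear: "linear c"
    and quasiconvex: "\<And>\<mu>. quasiconvex_on C (\<lambda>x. f x + \<mu> * c x)"
begin

lemma jensen_transversal:
  assumes uv: "u \<in> C" "v \<in> C" and t: "0 < t" "t < 1" and ne: "c u \<noteq> c v"
  shows "f ((1 - t) *\<^sub>R v + t *\<^sub>R u) \<le> (1 - t) * f v + t * f u"
proof -
  \<comment> \<open>\<open>\<mu>\<close> solves
    \<open>f u + \<mu> * c u = f v + \<mu> * c v\<close>. The maximum in quasiconvexity is then this
    common value, hence also any convex combination of the two endpoint values, and the
    \<open>c\<close> terms cancel.\<close>
  define \<mu> where "\<mu> = (f u - f v) / (c v - c u)"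
  have eq: "f u + \<mu> * c u = f v + \<mu> * c v"
    using ne by (simp add: \<mu>_def field_simps)
  have "f (v + t *\<^sub>R (u - v)) + \<mu> * c (v + t *\<^sub>R (u - v)) \<le> f v + \<mu> * c v"
    using quasiconvex[of \<mu>] uv t eq unfolding quasiconvex_on_def by fastforce
  moreover have "v + t *\<^sub>R (u - v) = (1 - t) *\<^sub>R v + t *\<^sub>R u"
    by (simp add: algebra_simps)
  ultimately have "f ((1 - t) *\<^sub>R v + t *\<^sub>R u) + \<mu> * ((1 - t) * c v + t * c u)
      \<le> f v + \<mu> * c v"
    by (simp add: linear_add[OF linear] linear_cmul[OF linear])
  also have "\<dots> = (1 - t) * (f v + \<mu> * c v) + t * (f u + \<mu> * c u)"
    unfolding eq by (simp add: algebra_simps)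
  finally show ?thesis
    by (simp add: algebra_simps)
qed

text \<open>Two transversal inequalities compose: one on \<open>[u, w]\<close>, then one from
  \<open>v\<close> to a point \<open>y\<close> of that side, where \<open>r > 0\<close> forces
  \<open>c y \<noteq> c v\<close>. Going from \<open>w\<close> straight to the point on
  \<open>[u, v]\<close> would bring in the value of \<open>f\<close> there, which is the one to be
  estimated.\<close>

lemma jensen_triangle:
  assumes C: "u \<in> C" "v \<in> C" "w \<in> C" and t: "0 < t" "t < 1" and s: "0 < s" "s < 1"
    and c: "c u = c v" "c w \<noteq> c v"
  shows "f ((1 - s) *\<^sub>R ((1 - t) *\<^sub>R v + t *\<^sub>R u) + s *\<^sub>R w)
    \<le> (1 - s) * ((1 - t) * f v + t * f u) + s * f w"
proof -
  \<comment> \<open>the point is \<open>(1 - q) v + q y\<close> with \<open>y = (1 - r) u + r w\<close>\<close>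
  define q where "q = s + (1 - s) * t"
  define r where "r = s / q"
  define y where "y = (1 - r) *\<^sub>R u + r *\<^sub>R w"
  have st: "0 < (1 - s) * t" "0 < (1 - s) * (1 - t)"
    using s t by simp_all
  have q1: "1 - q = (1 - s) * (1 - t)"
    by (simp add: q_def algebra_simps)
  have q: "0 < q" "q < 1"
    using st s q1 by (simp_all add: q_def)
  have qr: "q * r = s"
    using q by (simp add: r_def)
  have qr1: "q * (1 - r) = (1 - s) * t"
    using qr by (simp add: right_diff_distrib q_def)
  have r: "0 < r" "r < 1"
    using q s st by (simp_all add: r_def q_def)
  have fy: "f y \<le> (1 - r) * f u + r * f w"
    unfolding y_def using C c r by (intro jensen_transversal) auto
  have y: "y \<in> C"
    unfolding y_def using convexD_alt[OF convex C(1,3)] r by simp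
  have "c y = c v + r * (c w - c v)"
    unfolding y_def linear_add[OF linear] linear_cmul[OF linear] by (simp add: c algebra_simps)
  then have "c y \<noteq> c v"
    using r c by simp
  then have "f ((1 - q) *\<^sub>R v + q *\<^sub>R y) \<le> (1 - q) * f v + q * f y"
    using C y q by (intro jensen_transversal) auto
  also have "(1 - q) *\<^sub>R v + q *\<^sub>R y = (1 - s) *\<^sub>R ((1 - t) *\<^sub>R v + t *\<^sub>R u) + s *\<^sub>R w"
    unfolding y_def scaleR_add_right scaleR_scaleR qr qr1 q1 by simp
  also have "(1 - q) * f v + q * f y \<le> (1 - q) * f v + q * ((1 - r) * f u + r * f w)"
    using fy q by simp
  also have "\<dots> = (1 - s) * ((1 - t) * f v + t * f u) + s * f w"
    unfolding distrib_left mult.assoc[symmetric] qr qr1 q1 by simp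
  finally show ?thesis .
qed

lemma convex_on_if_radially_lower_stable:
  assumes nonconst: "\<not> c constant_on C"
    and stable: "\<And>z. flat_point C z \<Longrightarrow> radially_lower_stable_at C f z"
  shows "convex_on C f"
proof (rule convex_onI[OF _ convex])
  fix t :: real and v u
  assume t: "0 < t" "t < 1" and uv: "v \<in> C" "u \<in> C"
  define z where "z = (1 - t) *\<^sub>R v + t *\<^sub>R u"
  define m where "m = (1 - t) * f v + t * f u"
  have zC: "z \<in> C"
    unfolding z_def using convexD_alt[OF convex uv] t by simp
  \<comment> \<open>The trivial case \<open>u = v\<close> is split off because flatness asks for
    distinct endpoints.\<close>
  have "f z \<le> m"
  proof (cases "c u = c v \<and> u \<noteq> v")
    case False
    then show ?thesis
    proof (cases "u = v")
      case True
      then show ?thesis by (simp add: z_def m_def algebra_simps flip: scaleR_add_left)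
    qed (use False t uv jensen_transversal[of u v t] in \<open>auto simp: z_def m_def\<close>)
  next
    case True
    then have cuv: "c u = c v" "u \<noteq> v" by auto
    obtain w where w: "w \<in> C" "c w \<noteq> c v"
      using nonconst unfolding constant_on_def by blast
    have cz: "c z = c v"
      unfolding z_def linear_add[OF linear] linear_cmul[OF linear] by (simp add: cuv algebra_simps)
    \<comment> \<open>The right side does not involve \<open>f z\<close> and tends to
      \<open>m\<close> as \<open>s\<close> tends to 0.\<close>
    have zs: "f ((1 - s) *\<^sub>R z + s *\<^sub>R w) \<le> (1 - s) * m + s * f w" if "0 < s" "s < 1" for s
      unfolding z_def m_def using jensen_triangle uv w t that cuv by blast
    have ev: "\<forall>\<^sub>F s::real in at_right 0. 0 < s \<and> s < 1"
      using eventually_at_right_less[of "0::real"] eventually_at_right_real[of 0 "1::real"]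
      by (auto elim: eventually_elim2)
    show ?thesis
    proof (cases "flat_point C z")
      case True
      have "ereal (f z) \<le> Limsup (at_right 0) (\<lambda>s. ereal (f (z + s *\<^sub>R (w - z))))"
        using stable[OF True] w(1) unfolding radially_lower_stable_at_def by blast
      also have "\<dots> \<le> Limsup (at_right 0) (\<lambda>s. ereal ((1 - s) * m + s * f w))"
      proof (rule Limsup_mono, rule eventually_mono[OF ev])
        fix s :: real assume "0 < s \<and> s < 1"
        moreover have "z + s *\<^sub>R (w - z) = (1 - s) *\<^sub>R z + s *\<^sub>R w"
          by (simp add: algebra_simps)
        ultimately show "ereal (f (z + s *\<^sub>R (w - z))) \<le> ereal ((1 - s) * m + s * f w)"
          using zs by simp
      qed
      also have "\<dots> = ereal m"
      proof (rule lim_imp_Limsup)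
        have "((\<lambda>s. (1 - s) * m + s * f w) \<longlongrightarrow> (1 - 0) * m + 0 * f w) (at_right (0::real))"
          by (intro tendsto_intros)
        then show "((\<lambda>s. ereal ((1 - s) * m + s * f w)) \<longlongrightarrow> ereal m) (at_right (0::real))"
          by simp
      qed simp
      finally show ?thesis by simp
    next
      case False
      have "z \<in> open_segment u v"
        unfolding in_segment using cuv t
        by (auto intro!: exI[of _ "1 - t"] simp: z_def algebra_simps)
      moreover have "w \<noteq> z" using w cz by auto
      \<comment> \<open>Since \<open>z\<close> lies strictly between the distinct points
        \<open>u\<close> and \<open>v\<close>, non-flatness forces the segment from \<open>w\<close>
        to \<open>z\<close> to extend beyond \<open>z\<close> inside \<open>C\<close>.\<close>
      ultimately obtain w' where w': "w' \<in> C" "w' \<noteq> w" "z \<in> open_segment w w'"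
        using False zC uv w(1) cuv(2) unfolding flat_point_def by metis
      then obtain p where p: "0 < p" "p < 1" and zp: "z = (1 - p) *\<^sub>R w + p *\<^sub>R w'"
        unfolding in_segment by auto
      have cp: "c v = (1 - p) * c w + p * c w'"
        using cz unfolding zp by (simp add: linear_add[OF linear] linear_cmul[OF linear])
      \<comment> \<open>Equality would give \<open>c v = c w\<close>, by \<open>cp\<close>.\<close>
      have cne: "c w' \<noteq> c w"
        using w(2) unfolding cp by (auto simp: algebra_simps)
      \<comment> \<open>solves \<open>z = (1 - a) z\<^sub>s + a w'\<close> for \<open>a\<close>, where \<open>z\<^sub>s = (1 - s) z + s w\<close>\<close>
      define a where "a s = s * p / ((1 - p) + s * p)" for s
      have bound: "f z \<le> (1 - a s) * ((1 - s) * m + s * f w) + a s * f w'"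
        if s: "0 < s" "s < 1" for s
      proof -
        define x where "x = (1 - s) *\<^sub>R z + s *\<^sub>R w"
        have D: "0 < (1 - p) + s * p" using s p by (simp add: add_pos_pos)
        have a: "0 < a s" "a s < 1"
          using s p D by (auto simp: a_def)
        have xC: "x \<in> C"
          unfolding x_def using convexD_alt[OF convex zC w(1)] s by simp
        have xw: "x = (s + (1 - s) * (1 - p)) *\<^sub>R w + ((1 - s) * p) *\<^sub>R w'"
          unfolding x_def zp by (simp add: algebra_simps)
        \<comment> \<open>The coefficients of \<open>w\<close> and \<open>w'\<close> in
          \<open>x\<close> sum to 1, so the difference is a positive multiple of
          \<open>c w - c w'\<close> and the segment from \<open>x\<close> to \<open>w'\<close> is
          transversal.\<close>
        have "c x - c w' = (s + (1 - s) * (1 - p)) * (c w - c w')"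
          unfolding xw linear_add[OF linear] linear_cmul[OF linear] by (simp add: algebra_simps)
        moreover have "0 < s + (1 - s) * (1 - p)"
          using s p by (simp add: add_pos_pos)
        ultimately have "c w' \<noteq> c x"
          using cne by auto
        \<comment> \<open>\<open>ca\<close> and \<open>cb\<close> match the coefficients of
          \<open>w'\<close> and \<open>w\<close> with those in \<open>zp\<close>.\<close>
        have ca: "(1 - a s) * ((1 - s) * p) + a s = p"
        proof -
          have "a s * ((1 - p) + s * p) = s * p"
            using D by (simp add: a_def)
          then show ?thesis
            by (simp add: algebra_simps)
        qed
        have "(1 - a s) * (s + (1 - s) * (1 - p)) = 1 - ((1 - a s) * ((1 - s) * p) + a s)"
          by (simp add: algebra_simps)
        then have cb: "(1 - a s) * (s + (1 - s) * (1 - p)) = 1 - p"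
          using ca by simp
        have "(1 - a s) *\<^sub>R x + a s *\<^sub>R w' = ((1 - a s) * (s + (1 - s) * (1 - p))) *\<^sub>R w
            + ((1 - a s) * ((1 - s) * p) + a s) *\<^sub>R w'"
          unfolding xw scaleR_add_right scaleR_scaleR by (simp add: scaleR_add_left)
        then have "z = (1 - a s) *\<^sub>R x + a s *\<^sub>R w'"
          unfolding ca cb zp by simp
        then have "f z \<le> (1 - a s) * f x + a s * f w'"
          using jensen_transversal[OF w'(1) xC a \<open>c w' \<noteq> c x\<close>] by simp
        also have "\<dots> \<le> (1 - a s) * ((1 - s) * m + s * f w) + a s * f w'"
          using zs[OF s] a by (simp add: x_def)
        finally show ?thesis .
      qed
      \<comment> \<open>The denominator tends to \<open>1 - p > 0\<close>, so the weight of
        \<open>f w'\<close> vanishes and the bound on \<open>f z\<close> tends to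
        \<open>m\<close>.\<close>
      have "(a \<longlongrightarrow> 0 * p / ((1 - p) + 0 * p)) (at_right 0)"
        unfolding a_def using p by (intro tendsto_intros) auto
      then have "(a \<longlongrightarrow> 0) (at_right 0)" by simp
      then have "((\<lambda>s. (1 - a s) * ((1 - s) * m + s * f w) + a s * f w')
          \<longlongrightarrow> (1 - 0) * ((1 - 0) * m + 0 * f w) + 0 * f w') (at_right 0)"
        by (intro tendsto_intros)
      then have "((\<lambda>s. (1 - a s) * ((1 - s) * m + s * f w) + a s * f w') \<longlongrightarrow> m) (at_right 0)"
        by simp
      then show ?thesis
        by (rule tendsto_lowerbound) (use ev bound in \<open>auto elim: eventually_mono\<close>)
    qed
  qed
  then show "f ((1 - t) *\<^sub>R v + t *\<^sub>R u) \<le> (1 - t) * f v + t * f u"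
    by (simp add: z_def m_def)
qed

end

theorem theorem1:
  fixes C :: "'a::real_vector set" and f :: "'a \<Rightarrow> real"
  assumes "convex C"
    and "\<exists>x\<in>C. \<exists>y\<in>C. x \<noteq> y"
    and "\<And>z. flat_point C z \<Longrightarrow> radially_lower_stable_at C f z"
  shows "convex_on C f \<longleftrightarrow>
    (\<exists>c :: 'a \<Rightarrow> real. linear c \<and> \<not> c constant_on C \<and>
       (\<forall>\<mu>::real. quasiconvex_on C (\<lambda>x. f x + \<mu> * c x)))"
proof
  assume f: "convex_on C f"
  obtain x y where xy: "x \<in> C" "y \<in> C" "x \<noteq> y"
    using assms(2) by blast
  obtain c :: "'a \<Rightarrow> real" where c: "linear c" "c x \<noteq> c y"
    using exists_linear_separating_points[OF xy(3)] .
  have "\<not> c constant_on C"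
    using xy c(2) unfolding constant_on_def by metis
  then show "\<exists>c :: 'a \<Rightarrow> real. linear c \<and> \<not> c constant_on C \<and>
      (\<forall>\<mu>::real. quasiconvex_on C (\<lambda>x. f x + \<mu> * c x))"
    using c(1) convex_on_imp_quasiconvex_on[OF convex_on_add_linear[OF f c(1)]] by blast
next
  assume "\<exists>c :: 'a \<Rightarrow> real. linear c \<and> \<not> c constant_on C \<and>
      (\<forall>\<mu>::real. quasiconvex_on C (\<lambda>x. f x + \<mu> * c x))"
  then obtain c :: "'a \<Rightarrow> real" where c: "linear c" "\<not> c constant_on C"
      "\<And>\<mu>. quasiconvex_on C (\<lambda>x. f x + \<mu> * c x)"
    by blast
  interpret quasiconvex_linear_perturbations C f c
    by (rule quasiconvex_linear_perturbations.intro) (fact assms(1) c)+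
  show "convex_on C f"
    using convex_on_if_radially_lower_stable[OF c(2) assms(3)] .
qed

end
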